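(* Let $Y \subset \mathbb{R}$ be a non-empty set and let $X = Y^{\mathbb{N}}$ be the set of all sequences $x = (x_1, x_2, \dots)$ with $x_n \in Y$ for all $n \in \mathbb{N}$. There exists a social welfare function $W : X \to \mathbb{R}$ satisfying asymptotic density-one Pareto and anonymity if and only if $|Y| < \infty$ (i.e., $Y$ is finite).
   Context: $\mathbb{N} = \{1,2,3,\dots\}$. For $x,y \in X$, $x \geq y$ means $x_n \geq y_n$ for all $n \in \mathbb{N}$. For $S \subset \mathbb{N}$, the asymptotic density is $d(S) = \lim_{n\to\infty} |S \cap \{1,\dots,n\}|/n$ when this limit exists. A social welfare order on $X$ is a complete and transitive binary relation $\succsim$ on $X$; $x \sim y$ means $x \succsim y$ and $y \succsim x$; $x \succ y$ means $x \succsim y$ but not $y \succsim x$. A social welfare function is a map $W : X \to \mathbb{R}$; it represents the social welfare order $\succsim$ given by $x \succsim y \iff W(x) \geq W(y)$. A social welfare function satisfies an axiom if the social welfare order it represents does. Anonymity: if $x,y \in X$ and there exist $i,j \in \mathbb{N}$ such that $y_j = x_i$, $x_j = y_i$ and $y_k = x_k$ for all $k \in \mathbb{N} \setminus \{i,j\}$, then $x \sim y$. Asymptotic density-one Pareto: if $x,y \in X$, $x \geq y$, and there is $S \subset \mathbb{N}$ with $d(S) = 1$ and $x_i > y_i$ for all $i \in S$, then $x \succ y$. *)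

theory Defs
  imports Complex_Main "HOL-Library.FuncSet"
begin

text \<open>The naturals start at 1, so the space of sequences \<open>Y\<^sup>\<nat>\<close> is the extensional
  function space over the index set \<open>{1..}\<close>; the value at index 0 is the fixed dummy
  \<^const>\<open>undefined\<close>.\<close>

definition seqs :: "real set \<Rightarrow> (nat \<Rightarrow> real) set" where
  "seqs Y = {1..} \<rightarrow>\<^sub>E Y"

text \<open>\<open>has_density S d\<close>: the asymptotic density of \<open>S\<close> exists and equals \<open>d\<close>.\<close>

definition has_density :: "nat set \<Rightarrow> real \<Rightarrow> bool" where
  "has_density S d \<longleftrightarrow> (\<lambda>n. real (card (S \<inter> {1..n})) / real n) \<longlonglongrightarrow> d"

definition social_welfare_order :: "'a set \<Rightarrow> ('a \<Rightarrow> 'a \<Rightarrow> bool) \<Rightarrow> bool" where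
  "social_welfare_order X R \<longleftrightarrow>
     (\<forall>x\<in>X. \<forall>y\<in>X. R x y \<or> R y x) \<and>
     (\<forall>x\<in>X. \<forall>y\<in>X. \<forall>z\<in>X. R x y \<longrightarrow> R y z \<longrightarrow> R x z)"

definition indifferent :: "('a \<Rightarrow> 'a \<Rightarrow> bool) \<Rightarrow> 'a \<Rightarrow> 'a \<Rightarrow> bool" where
  "indifferent R x y \<longleftrightarrow> R x y \<and> R y x"

definition strictly_preferred :: "('a \<Rightarrow> 'a \<Rightarrow> bool) \<Rightarrow> 'a \<Rightarrow> 'a \<Rightarrow> bool" where
  "strictly_preferred R x y \<longleftrightarrow> R x y \<and> \<not> R y x"

definition anonymity :: "(nat \<Rightarrow> real) set \<Rightarrow> ((nat \<Rightarrow> real) \<Rightarrow> (nat \<Rightarrow> real) \<Rightarrow> bool) \<Rightarrow> bool" where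
  "anonymity X R \<longleftrightarrow>
     (\<forall>x\<in>X. \<forall>y\<in>X.
        (\<exists>i\<in>{1..}. \<exists>j\<in>{1..}. y j = x i \<and> x j = y i \<and> (\<forall>k\<in>{1..} - {i, j}. y k = x k))
        \<longrightarrow> indifferent R x y)"

definition density_one_pareto ::
    "(nat \<Rightarrow> real) set \<Rightarrow> ((nat \<Rightarrow> real) \<Rightarrow> (nat \<Rightarrow> real) \<Rightarrow> bool) \<Rightarrow> bool" where
  "density_one_pareto X R \<longleftrightarrow>
     (\<forall>x\<in>X. \<forall>y\<in>X.
        (\<forall>n\<in>{1..}. x n \<ge> y n) \<and> (\<exists>S\<subseteq>{1..}. has_density S 1 \<and> (\<forall>i\<in>S. x i > y i))
        \<longrightarrow> strictly_preferred R x y)"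

text \<open>A social welfare function on \<open>X\<close> is given by a total HOL function \<open>W\<close>; only its values
  on \<open>X\<close> enter the order it represents.\<close>

definition represented_order :: "'a set \<Rightarrow> ('a \<Rightarrow> real) \<Rightarrow> 'a \<Rightarrow> 'a \<Rightarrow> bool" where
  "represented_order X W x y \<longleftrightarrow> x \<in> X \<and> y \<in> X \<and> W x \<ge> W y"

lemma social_welfare_order_represented_order:
  "social_welfare_order X (represented_order X W)"
  unfolding social_welfare_order_def represented_order_def by force

end

theory Submission
  imports Defs "HOL-Library.Discrete_Functions" "HOL-Library.Nat_Bijection"
    "HOL-Analysis.Continuum_Not_Denumerable"
begin

text \<open>
  If \<open>Y\<close> is finite, the upper limit of the averages of \<open>x\<close> is a welfare function: distinct
  elements of \<open>Y\<close> are a fixed distance apart, so a gain on a set of density one raises the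
  averages eventually by a positive constant.

  If \<open>Y\<close> is infinite, it contains a strictly monotone sequence, so it is enough to exclude a
  welfare function \<open>V\<close> on sequences of natural numbers. Outside the squares let \<open>F r\<close> be
  \<open>n \<mapsto> \<lfloor>n r\<rfloor>\<close> and let \<open>G r = F r + 1\<close>, so that \<open>V (F r) < V (G r)\<close>. For \<open>r < s\<close>
  the sequence \<open>F s\<close> exceeds \<open>G r\<close> outside the squares with finitely many exceptions. These are
  repaired by finitely many transpositions with squares at which \<open>G r\<close> vanishes while \<open>F s\<close>
  is large, whence \<open>V (G r) < V (F s)\<close>. The intervals from \<open>V (F r)\<close> to \<open>V (G r)\<close> with
  \<open>0 < r < 1\<close> would then be uncountably many disjoint intervals of positive length.
\<close>

section \<open>Sets of density one\<close>

lemma has_density_Int_atLeast_1: "has_density (S \<inter> {1..}) d \<longleftrightarrow> has_density S d"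
proof -
  have "S \<inter> {1..} \<inter> {1..n} = S \<inter> {1..n}" for n :: nat by auto
  then show ?thesis unfolding has_density_def by simp
qed

lemma has_density_UNIV: "has_density UNIV 1"
proof -
  have "eventually (\<lambda>n. real (card (UNIV \<inter> {1..n})) / real n = 1) sequentially"
    using eventually_gt_at_top[of "0::nat"] by eventually_elim simp
  then show ?thesis unfolding has_density_def by (rule tendsto_eventually)
qed

lemma has_density_finite:
  assumes "finite S"
  shows "has_density S 0"
  unfolding has_density_def
proof (rule tendsto_sandwich[of "\<lambda>_. 0" _ _ "\<lambda>n. real (card S) / real n"])
  show "\<forall>\<^sub>F n in sequentially. real (card (S \<inter> {1..n})) / real n \<le> real (card S) / real n"
    using assms by (auto intro!: always_eventually divide_right_mono card_mono)
qed (auto intro: lim_const_over_n)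

text \<open>Every positive square up to \<open>n\<close> has its root in
  \<open>{1..floor_sqrt n}\<close>, so the ratio is at most \<open>1 / sqrt n\<close>.\<close>

lemma has_density_squares: "has_density (range (\<lambda>k::nat. k\<^sup>2)) 0"
  unfolding has_density_def
proof (rule tendsto_sandwich[of "\<lambda>_. 0" _ _ "\<lambda>n. 1 / sqrt (real n)"])
  have "real (card (range (\<lambda>k::nat. k\<^sup>2) \<inter> {1..n})) / real n \<le> 1 / sqrt (real n)"
    if "n > 0" for n :: nat
  proof -
    have "range (\<lambda>k::nat. k\<^sup>2) \<inter> {1..n} \<subseteq> (\<lambda>k. k\<^sup>2) ` {1..floor_sqrt n}"
      by (auto simp: le_floor_sqrt_iff Suc_le_eq)
    then have "card (range (\<lambda>k::nat. k\<^sup>2) \<inter> {1..n}) \<le> card {1..floor_sqrt n}"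
      by (rule surj_card_le[rotated]) auto
    then have "real (card (range (\<lambda>k::nat. k\<^sup>2) \<inter> {1..n})) \<le> real (floor_sqrt n)"
      by simp
    also have "\<dots> \<le> sqrt (real n)"
      by (rule real_le_rsqrt) (metis floor_sqrt_power2_le of_nat_le_iff of_nat_power)
    finally have "real (card (range (\<lambda>k::nat. k\<^sup>2) \<inter> {1..n})) / real n \<le> sqrt (real n) / real n"
      by (rule divide_right_mono) simp
    also have "\<dots> = 1 / sqrt (real n)"
      using that by (simp add: field_simps)
    finally show ?thesis .
  qed
  then show "\<forall>\<^sub>F n in sequentially.
      real (card (range (\<lambda>k::nat. k\<^sup>2) \<inter> {1..n})) / real n \<le> 1 / sqrt (real n)"
    by (rule eventually_mono[OF eventually_gt_at_top[of "0::nat"]])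
  show "(\<lambda>n. 1 / sqrt (real n)) \<longlonglongrightarrow> 0"
    by (intro tendsto_divide_0[OF tendsto_const] filterlim_at_top_imp_at_infinity
        filterlim_compose[OF sqrt_at_top] filterlim_real_sequentially)
qed auto

lemma has_density_diff:
  assumes "has_density S 1" "has_density T 0"
  shows "has_density (S - T) 1"
  unfolding has_density_def
proof (rule tendsto_sandwich)
  let ?d = "\<lambda>S n. real (card (S \<inter> {1..n})) / real n"
  have "card (S \<inter> {1..n}) \<le> card ((S - T) \<inter> {1..n}) + card (T \<inter> {1..n})" for n
    by (rule order_trans[OF card_mono card_Un_le]) auto
  then have "?d S n \<le> ?d (S - T) n + ?d T n" for n
    by (simp flip: add_divide_distrib of_nat_add add: divide_right_mono)
  then show "\<forall>\<^sub>F n in sequentially. ?d S n - ?d T n \<le> ?d (S - T) n"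
    by (simp add: algebra_simps)
  show "\<forall>\<^sub>F n in sequentially. ?d (S - T) n \<le> ?d S n"
    by (auto intro!: always_eventually divide_right_mono card_mono)
  show "(\<lambda>n. ?d S n - ?d T n) \<longlonglongrightarrow> 1"
    using tendsto_diff[OF assms[unfolded has_density_def]] by simp
  show "?d S \<longlonglongrightarrow> 1"
    using assms(1) by (simp add: has_density_def)
qed

section \<open>The impossibility for sequences of natural numbers\<close>

text \<open>Values in the naturals make this interface fit both increasing and decreasing sequences
  in \<open>Y\<close>.\<close>

locale nat_welfare =
  fixes V :: "(nat \<Rightarrow> nat) \<Rightarrow> real"
  assumes pareto: "\<And>x y S. (\<And>n. n \<ge> 1 \<Longrightarrow> y n \<le> x n) \<Longrightarrow> has_density S 1 \<Longrightarrow>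
      (\<And>n. n \<in> S \<Longrightarrow> y n < x n) \<Longrightarrow> V y < V x"
    and anonymous: "\<And>x i j. i \<ge> 1 \<Longrightarrow> j \<ge> 1 \<Longrightarrow> V (x(i := x j, j := x i)) = V x"
begin

text \<open>Induction on \<open>D\<close>: exchanging the entry of \<open>y\<close> at
  \<open>d\<close> with a zero at some \<open>t\<close> in \<open>T\<close> leaves
  \<open>V y\<close> unchanged and repairs \<open>d\<close>, while \<open>t\<close> stays dominated
  because \<open>y d \<le> x t\<close>. Strictness may be lost at \<open>d\<close> and
  \<open>t\<close>, so both leave \<open>S\<close>. An infinite \<open>T\<close> never runs out of
  zeros.\<close>

lemma pareto_finite_exceptions:
  assumes "finite D" "infinite T" "D \<subseteq> {1..}" "T \<subseteq> {1..}" "D \<inter> T = {}"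
    and "\<And>t. t \<in> T \<Longrightarrow> y t = 0"
    and "\<And>d t. d \<in> D \<Longrightarrow> t \<in> T \<Longrightarrow> y d \<le> x t"
    and "\<And>n. n \<ge> 1 \<Longrightarrow> n \<notin> D \<Longrightarrow> y n \<le> x n"
    and "has_density S 1" "\<And>n. n \<in> S \<Longrightarrow> y n < x n"
  shows "V y < V x"
  using assms
proof (induction D arbitrary: y T S rule: finite_induct)
  case empty
  then show ?case by (intro pareto[of y x S]) auto
next
  case (insert d D)
  obtain t where t: "t \<in> T"
    using insert.prems(1) by (metis finite.emptyI ex_in_conv)
  have dt: "d \<ge> 1" "t \<ge> 1" "t \<noteq> d" "t \<notin> D" "y t = 0" "y d \<le> x t" "d \<notin> T"
    using t insert.prems by auto
  have "V (y(d := y t, t := y d)) < V x"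
  proof (rule insert.IH[of "T - {t}" _ "S - {d, t}"])
    show "has_density (S - {d, t}) 1"
      using insert.prems by (intro has_density_diff has_density_finite) auto
  qed (use insert.prems insert.hyps dt in auto)
  then show ?case
    using anonymous[of d t y] dt by simp
qed

end

text \<open>At the square of a code \<open>k\<close> of the fraction \<open>p / q\<close> the sequence \<open>F r\<close> records, with a value
  that grows with \<open>k\<close>, whether \<open>p / q < r\<close>.\<close>

definition F :: "real \<Rightarrow> nat \<Rightarrow> nat" where
  "F r n = (if n \<in> range (\<lambda>k. k\<^sup>2)
     then (let k = floor_sqrt n; (p, q) = prod_decode k in if real p < r * real q then k else 0)
     else nat \<lfloor>real n * r\<rfloor>)"

text \<open>The squares are left alone so that the zeros of \<open>F r\<close> there remain
  available for exchanges.\<close>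

definition G :: "real \<Rightarrow> nat \<Rightarrow> nat" where
  "G r n = (if n \<in> range (\<lambda>k. k\<^sup>2) then F r n else F r n + 1)"

lemma F_square:
  "F r (k\<^sup>2) = (if real (fst (prod_decode k)) < r * real (snd (prod_decode k)) then k else 0)"
  by (simp add: F_def case_prod_unfold Let_def)

lemma F_mono:
  assumes "r \<le> s"
  shows "F r n \<le> F s n"
proof (cases "n \<in> range (\<lambda>k. k\<^sup>2)")
  case True
  then obtain k where "n = k\<^sup>2" by blast
  moreover have "r * real q \<le> s * real q" for q
    using assms by (simp add: mult_right_mono)
  ultimately show ?thesis
    using order_less_le_trans by (fastforce simp: F_square)
next
  case False
  then show ?thesis
    using assms by (simp add: F_def nat_mono floor_mono mult_left_mono)
qed

text \<open>These are the codes \<open>k\<close> for which \<open>F r\<close> vanishes at the square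
  of \<open>k\<close> while \<open>F s\<close> equals \<open>k\<close> there. Every large
  denominator \<open>q\<close> admits a numerator, and the code is at least
  \<open>q\<close>.\<close>

lemma infinite_codes_between:
  fixes r s :: real
  assumes "0 < r" "r < s"
  shows "infinite {k. r * real (snd (prod_decode k)) \<le> real (fst (prod_decode k)) \<and>
    real (fst (prod_decode k)) < s * real (snd (prod_decode k))}" (is "infinite ?A")
  unfolding infinite_nat_iff_unbounded
proof
  fix m :: nat
  \<comment> \<open>The first bound makes the interval from \<open>r * q\<close> to
    \<open>s * q\<close> longer than 1, so it contains the integer \<open>p\<close>; the second
    pushes the code beyond \<open>m\<close>.\<close>
  obtain q where q: "real q > max (1 / (s - r)) (real m)"
    using reals_Archimedean2 by blast
  then have "real q * (s - r) > 1"
    using assms by (simp add: field_simps)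
  define p where "p = nat \<lceil>r * real q\<rceil>"
  have "r * real q \<ge> 0" using assms by simp
  then have "real p = of_int \<lceil>r * real q\<rceil>" by (simp add: p_def)
  then have "r * real q \<le> real p" "real p < r * real q + 1"
    by linarith+
  moreover have "real p < s * real q"
    using \<open>real p < r * real q + 1\<close> \<open>real q * (s - r) > 1\<close> by (simp add: algebra_simps)
  ultimately have "prod_encode (p, q) \<in> ?A" by simp
  moreover have "prod_encode (p, q) > m"
    using le_prod_encode_2[of q p] q by simp
  ultimately show "\<exists>n>m. n \<in> ?A" by blast
qed

context nat_welfare
begin

lemma V_F_less_V_G: "V (F r) < V (G r)"
proof (rule pareto)
  show "has_density (UNIV - range (\<lambda>k. k\<^sup>2)) 1"
    by (intro has_density_diff has_density_UNIV has_density_squares)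
qed (auto simp: G_def)

lemma V_G_less_V_F:
  assumes "0 < r" "r < s"
  shows "V (G r) < V (F s)"
proof -
  let ?Q = "range (\<lambda>k::nat. k\<^sup>2)"
  \<comment> \<open>From \<open>N\<close> on, \<open>n * s\<close> exceeds \<open>n * r\<close> by
    more than 2, so the floors differ by at least 2: one unit for the increment in \<open>G\<close>,
    one for strictness.\<close>
  obtain N :: nat where N: "real N > 2 / (s - r)"
    using reals_Archimedean2 by blast
  have less: "G r n < F s n" if "n \<ge> N" "n \<notin> ?Q" for n
  proof -
    have "real n > 2 / (s - r)"
      using N that by (meson of_nat_le_iff order_less_le_trans)
    then have "real n * s > real n * r + 2"
      using assms by (simp add: field_simps)
    then have "\<lfloor>real n * r\<rfloor> + 1 < \<lfloor>real n * s\<rfloor>" by linarith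
    moreover have "\<lfloor>real n * r\<rfloor> \<ge> 0" using assms by simp
    ultimately have "nat \<lfloor>real n * r\<rfloor> + 1 < nat \<lfloor>real n * s\<rfloor>" by linarith
    then show ?thesis
      using that by (simp add: G_def F_def)
  qed
  define D where "D = {1..<N} - ?Q"
  \<comment> \<open>The inserted 1 covers an empty \<open>D\<close> and forces
    \<open>M \<ge> 1\<close>, which keeps the square 0 out of \<open>T\<close>.\<close>
  define M where "M = Max (insert 1 (G r ` D))"
  have finD: "finite D" by (simp add: D_def)
  have M: "1 \<le> M" "\<And>d. d \<in> D \<Longrightarrow> G r d \<le> M"
    by (auto simp: M_def finD)
  let ?A = "{k. r * real (snd (prod_decode k)) \<le> real (fst (prod_decode k)) \<and>
    real (fst (prod_decode k)) < s * real (snd (prod_decode k))}"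
  \<comment> \<open>Codes \<open>k \<ge> M\<close> make \<open>F s\<close> at these squares at least
    as large as every value of \<open>G r\<close> on \<open>D\<close>.\<close>
  define T where "T = (\<lambda>k::nat. k\<^sup>2) ` (?A - {..<M})"
  show ?thesis
  proof (rule pareto_finite_exceptions[of D T _ _ "UNIV - ?Q - {..<N}"])
    have "infinite (?A - {..<M})"
      using infinite_codes_between[OF assms] by simp
    moreover have "inj_on (\<lambda>k::nat. k\<^sup>2) (?A - {..<M})"
      by (auto simp: inj_on_def)
    ultimately show "infinite T"
      unfolding T_def using finite_imageD by blast
    show "T \<subseteq> {1..}"
      using M(1) by (auto simp: T_def Suc_le_eq)
    show "G r t = 0" if "t \<in> T" for t
      using that by (auto simp: T_def G_def F_square)
    show "G r d \<le> F s t" if "d \<in> D" "t \<in> T" for d t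
      using that M(2)[of d] by (auto simp: T_def F_square)
    show "G r n \<le> F s n" if "n \<ge> 1" "n \<notin> D" for n
      using that less[of n] F_mono[of r s n] assms by (cases "n \<in> ?Q") (auto simp: D_def G_def)
    show "has_density (UNIV - ?Q - {..<N}) 1"
      by (intro has_density_diff has_density_UNIV has_density_squares has_density_finite) auto
  qed (use less finD in \<open>auto simp: D_def T_def\<close>)
qed

text \<open>A rational chosen between \<open>V (F r)\<close> and \<open>V (G r)\<close> increases
  strictly with \<open>r\<close>, which would embed the interval from 0 to 1 into the
  rationals.\<close>

lemma inconsistent: False
proof -
  have "\<exists>q\<in>\<rat>. V (F r) < q \<and> q < V (G r)" for r
    using Rats_dense_in_real[OF V_F_less_V_G] by blast
  then obtain q where q: "q r \<in> \<rat>" "V (F r) < q r" "q r < V (G r)" for r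
    by metis
  have "q r < q s" if "0 < r" "r < s" for r s
    using V_G_less_V_F[OF that] q(3)[of r] q(2)[of s] by linarith
  then have "inj_on q {0<..<1}"
    by (intro linorder_inj_onI) fastforce+
  moreover have "countable (q ` {0<..<1})"
    using q(1) by (intro countable_subset[OF _ countable_rat]) auto
  ultimately have "countable {0<..<1::real}"
    by (rule countable_image_inj_on[rotated])
  then show False
    using uncountable_open_interval[of 0 "1::real"] by simp
qed

end

section \<open>Welfare functions on real sequences\<close>

locale welfare =
  fixes Y :: "real set" and W :: "(nat \<Rightarrow> real) \<Rightarrow> real"
  assumes dop: "density_one_pareto (seqs Y) (represented_order (seqs Y) W)"
    and anon: "anonymity (seqs Y) (represented_order (seqs Y) W)"
begin

text \<open>Here \<open>S\<close> may contain 0: intersecting with \<open>{1..}\<close> changes no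
  density.\<close>

lemma W_less:
  assumes "x \<in> seqs Y" "y \<in> seqs Y" "\<And>n. n \<ge> 1 \<Longrightarrow> y n \<le> x n"
    and "has_density S 1" "\<And>n. n \<in> S \<Longrightarrow> n \<ge> 1 \<Longrightarrow> y n < x n"
  shows "W y < W x"
proof -
  have "has_density (S \<inter> {1..}) 1" "\<forall>i\<in>S \<inter> {1..}. y i < x i"
    using assms(4,5) by (simp_all only: has_density_Int_atLeast_1) auto
  then have "\<exists>S\<subseteq>{1..}. has_density S 1 \<and> (\<forall>i\<in>S. y i < x i)"
    by (intro exI[of _ "S \<inter> {1..}"]) simp
  then have "strictly_preferred (represented_order (seqs Y) W) x y"
    using dop assms(1-3) unfolding density_one_pareto_def by simp
  then show ?thesis
    using assms(1,2) by (auto simp: strictly_preferred_def represented_order_def)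
qed

lemma W_eq:
  assumes "x \<in> seqs Y" "y \<in> seqs Y" "i \<ge> 1" "j \<ge> 1" "y j = x i" "x j = y i"
    and "\<And>k. k \<noteq> i \<Longrightarrow> k \<noteq> j \<Longrightarrow> y k = x k"
  shows "W y = W x"
proof -
  have "\<exists>i\<in>{1..}. \<exists>j\<in>{1..}. y j = x i \<and> x j = y i \<and> (\<forall>k\<in>{1..} - {i, j}. y k = x k)"
    using assms(3-7) by (intro bexI[of _ i] bexI[of _ j]) auto
  then have "indifferent (represented_order (seqs Y) W) x y"
    using anon assms(1,2) unfolding anonymity_def by blast
  then show ?thesis
    by (auto simp: indifferent_def represented_order_def)
qed

text \<open>Composition with \<open>a\<close> preserves both orders, so \<open>W\<close> would
  induce a \<open>nat_welfare\<close>. The restriction sets index 0 to the dummy value that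
  \<open>seqs\<close> demands.\<close>

lemma not_strict_mono:
  fixes a :: "nat \<Rightarrow> real"
  assumes "range a \<subseteq> Y"
  shows "\<not> strict_mono a"
proof
  assume a: "strict_mono a"
  have X: "restrict (a \<circ> u) {1..} \<in> seqs Y" for u
    using assms by (auto simp: seqs_def)
  interpret nat_welfare "\<lambda>u. W (restrict (a \<circ> u) {1..})"
  proof
    fix x y :: "nat \<Rightarrow> nat" and S
    assume "\<And>n. n \<ge> 1 \<Longrightarrow> y n \<le> x n" "has_density S 1" "\<And>n. n \<in> S \<Longrightarrow> y n < x n"
    then show "W (restrict (a \<circ> y) {1..}) < W (restrict (a \<circ> x) {1..})"
      using a by (intro W_less[of _ _ S] X) (auto simp: strict_mono_less strict_mono_less_eq)
  next
    fix x :: "nat \<Rightarrow> nat" and i j :: nat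
    assume "i \<ge> 1" "j \<ge> 1"
    then show "W (restrict (a \<circ> x(i := x j, j := x i)) {1..}) = W (restrict (a \<circ> x) {1..})"
      by (intro W_eq[of _ _ i j] X) auto
  qed
  show False by (rule inconsistent)
qed

text \<open>Now composition with \<open>a\<close> reverses the order; negating \<open>W\<close>
  reverses it back.\<close>

lemma not_strict_antimono:
  fixes a :: "nat \<Rightarrow> real"
  assumes "range a \<subseteq> Y"
  shows "\<not> strict_mono (\<lambda>n. - a n)"
proof
  assume a: "strict_mono (\<lambda>n. - a n)"
  have X: "restrict (a \<circ> u) {1..} \<in> seqs Y" for u
    using assms by (auto simp: seqs_def)
  interpret nat_welfare "\<lambda>u. - W (restrict (a \<circ> u) {1..})"
  proof
    fix x y :: "nat \<Rightarrow> nat" and S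
    assume "\<And>n. n \<ge> 1 \<Longrightarrow> y n \<le> x n" "has_density S 1" "\<And>n. n \<in> S \<Longrightarrow> y n < x n"
    then have "W (restrict (a \<circ> x) {1..}) < W (restrict (a \<circ> y) {1..})"
      using strict_mono_less[OF a] strict_mono_less_eq[OF a]
      by (intro W_less[of _ _ S] X) auto
    then show "- W (restrict (a \<circ> y) {1..}) < - W (restrict (a \<circ> x) {1..})"
      by simp
  next
    fix x :: "nat \<Rightarrow> nat" and i j :: nat
    assume "i \<ge> 1" "j \<ge> 1"
    then have "W (restrict (a \<circ> x(i := x j, j := x i)) {1..}) = W (restrict (a \<circ> x) {1..})"
      by (intro W_eq[of _ _ i j] X) auto
    then show "- W (restrict (a \<circ> x(i := x j, j := x i)) {1..}) = - W (restrict (a \<circ> x) {1..})"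
      by simp
  qed
  show False by (rule inconsistent)
qed

text \<open>An infinite set contains an injective sequence; its monotone subsequence is strictly
  monotone by injectivity.\<close>

lemma finite_Y: "finite Y"
proof (rule ccontr)
  assume "infinite Y"
  then obtain b :: "nat \<Rightarrow> real" where b: "inj b" "range b \<subseteq> Y"
    using infinite_countable_subset by blast
  obtain f where f: "strict_mono f" "monoseq (\<lambda>n. b (f n))"
    using seq_monosub by blast
  define a where "a = b \<circ> f"
  have "range a \<subseteq> Y" "inj a"
    using b inj_compose[OF b(1) strict_mono_imp_inj_on[OF f(1)]] by (auto simp: a_def)
  moreover have "incseq a \<or> decseq a"
    using f(2) by (simp add: monoseq_iff a_def o_def)
  ultimately show False
    using not_strict_mono[of a] not_strict_antimono[of a]
    by (auto simp: strict_mono_iff_mono monotone_def inj_on_def)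
qed

end

section \<open>Upper limits of averages\<close>

definition avg :: "(nat \<Rightarrow> real) \<Rightarrow> nat \<Rightarrow> real" where
  "avg x n = (\<Sum>i=1..n. x i) / real n"

text \<open>The limit superior of the averages for bounded \<open>x\<close>, written as an infimum
  of eventual upper bounds to stay within the reals.\<close>

definition upper_avg :: "(nat \<Rightarrow> real) \<Rightarrow> real" where
  "upper_avg x = Inf {c. \<forall>\<^sub>F n in sequentially. avg x n \<le> c}"

lemma upper_avg_cong:
  assumes "\<forall>\<^sub>F n in sequentially. avg x n = avg y n"
  shows "upper_avg x = upper_avg y"
proof -
  have "(\<forall>\<^sub>F n in sequentially. avg x n \<le> c) \<longleftrightarrow> (\<forall>\<^sub>F n in sequentially. avg y n \<le> c)" for c
    by (rule eventually_cong[OF assms]) simp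
  then show ?thesis by (simp add: upper_avg_def)
qed

lemma abs_avg_le:
  assumes "\<And>i. i \<ge> 1 \<Longrightarrow> \<bar>x i\<bar> \<le> B" "n > 0"
  shows "\<bar>avg x n\<bar> \<le> B"
proof -
  have "\<bar>\<Sum>i=1..n. x i\<bar> \<le> (\<Sum>i=1..n. B)"
    using assms(1) by (intro order_trans[OF sum_abs] sum_mono) auto
  then show ?thesis
    using assms(2) by (simp add: avg_def field_simps)
qed

text \<open>Lowering an eventual upper bound for the averages of \<open>x\<close> by
  \<open>e\<close> gives one for \<open>y\<close>. The bound \<open>B\<close> makes the relevant
  sets nonempty and bounded below, as the real infimum requires.\<close>

lemma upper_avg_less:
  assumes "\<And>i. i \<ge> 1 \<Longrightarrow> \<bar>x i\<bar> \<le> B" "\<And>i. i \<ge> 1 \<Longrightarrow> \<bar>y i\<bar> \<le> B"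
    and "e > 0" "\<forall>\<^sub>F n in sequentially. avg y n + e \<le> avg x n"
  shows "upper_avg y < upper_avg x"
proof -
  have "upper_avg y + e \<le> upper_avg x"
    unfolding upper_avg_def[of x]
  proof (rule cInf_greatest)
    have "avg x n \<le> B" if "n > 0" for n
      using abs_avg_le[of x B n] assms(1) that by fastforce
    then have "\<forall>\<^sub>F n in sequentially. avg x n \<le> B"
      by (rule eventually_mono[OF eventually_gt_at_top[of "0::nat"]])
    then show "{c. \<forall>\<^sub>F n in sequentially. avg x n \<le> c} \<noteq> {}" by auto
    fix c assume "c \<in> {c. \<forall>\<^sub>F n in sequentially. avg x n \<le> c}"
    then have "\<forall>\<^sub>F n in sequentially. avg x n \<le> c" by simp
    with assms(4) have "\<forall>\<^sub>F n in sequentially. avg y n \<le> c - e"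
      by eventually_elim simp
    moreover have "bdd_below {c. \<forall>\<^sub>F n in sequentially. avg y n \<le> c}"
    proof (rule bdd_belowI)
      fix c assume "c \<in> {c. \<forall>\<^sub>F n in sequentially. avg y n \<le> c}"
      then have "\<forall>\<^sub>F n in sequentially. avg y n \<le> c \<and> n > 0"
        using eventually_gt_at_top[of "0::nat"] by (auto intro: eventually_conj)
      then obtain n where "avg y n \<le> c" "n > 0"
        using eventually_happens'[OF sequentially_bot] by blast
      moreover have "\<bar>avg y n\<bar> \<le> B"
        by (rule abs_avg_le) (use assms(2) \<open>n > 0\<close> in auto)
      ultimately show "- B \<le> c" by linarith
    qed
    ultimately have "upper_avg y \<le> c - e"
      unfolding upper_avg_def by (intro cInf_lower) auto
    then show "upper_avg y + e \<le> c" by simp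
  qed
  then show ?thesis using assms(3) by simp
qed

lemma finite_set_gap:
  fixes Y :: "real set"
  assumes "finite Y"
  obtains e where "e > 0" "\<And>a b. a \<in> Y \<Longrightarrow> b \<in> Y \<Longrightarrow> a < b \<Longrightarrow> a + e \<le> b"
proof
  \<comment> \<open>The inserted 1 keeps \<open>P\<close> nonempty when \<open>Y\<close> has fewer
    than two elements.\<close>
  define P where "P = insert 1 ((\<lambda>(a, b). b - a) ` {(a, b) \<in> Y \<times> Y. a < b})"
  have "finite {(a, b) \<in> Y \<times> Y. a < b}"
    by (rule finite_subset[of _ "Y \<times> Y"]) (use assms in auto)
  then have P: "finite P" "P \<noteq> {}" by (auto simp: P_def)
  then show "Min P > 0" by (auto simp: P_def)
  show "a + Min P \<le> b" if "a \<in> Y" "b \<in> Y" "a < b" for a b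
  proof -
    have "b - a \<in> P" using that by (force simp: P_def)
    then have "Min P \<le> b - a" using P by simp
    then show ?thesis by simp
  qed
qed

text \<open>Eventually \<open>S\<close> fills more than half of \<open>{1..n}\<close>, and each of
  its indices contributes at least \<open>e\<close>; the other indices lose nothing.\<close>

lemma avg_gap:
  assumes "has_density S 1" "e > 0"
    and "\<And>i. i \<ge> 1 \<Longrightarrow> y i \<le> x i" "\<And>i. i \<in> S \<Longrightarrow> i \<ge> 1 \<Longrightarrow> y i + e \<le> x i"
  shows "\<forall>\<^sub>F n in sequentially. avg y n + e / 2 \<le> avg x n"
proof -
  have "\<forall>\<^sub>F n in sequentially. real (card (S \<inter> {1..n})) / real n > 1 / 2"
    using assms(1) unfolding has_density_def by (rule order_tendstoD) simp
  then show ?thesis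
  proof eventually_elim
    case (elim n)
    have "e * real (card (S \<inter> {1..n})) = (\<Sum>i=1..n. if i \<in> S then e else 0)"
      by (simp add: sum.If_cases Int_commute)
    also have "\<dots> \<le> (\<Sum>i=1..n. x i - y i)"
      using assms(3,4) by (intro sum_mono) (auto simp: algebra_simps)
    finally have "e * (real (card (S \<inter> {1..n})) / real n) \<le> avg x n - avg y n"
      by (simp add: avg_def sum_subtractf divide_right_mono flip: diff_divide_distrib)
    moreover have "e * (1 / 2) \<le> e * (real (card (S \<inter> {1..n})) / real n)"
      using elim assms(2) by (intro mult_left_mono) auto
    ultimately show ?case by linarith
  qed
qed

text \<open>Once \<open>n\<close> reaches both \<open>i\<close> and \<open>j\<close>, the swap only
  permutes the summands.\<close>

lemma avg_swap:
  assumes "i \<ge> 1" "j \<ge> 1" "y j = x i" "x j = y i" "\<And>k. k \<in> {1..} - {i, j} \<Longrightarrow> y k = x k"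
  shows "\<forall>\<^sub>F n in sequentially. avg x n = avg y n"
  using eventually_ge_at_top[of "max i j"]
proof eventually_elim
  case (elim n)
  have "{1..n} = {i, j} \<union> ({1..n} - {i, j})"
    using assms elim by auto
  then have split: "(\<Sum>k=1..n. z k) = (\<Sum>k\<in>{i, j}. z k) + (\<Sum>k\<in>{1..n} - {i, j}. z k)" for z :: "nat \<Rightarrow> real"
    by (metis Diff_disjoint finite.emptyI finite.insertI finite_Diff finite_atLeastAtMost sum.union_disjoint)
  have "(\<Sum>k\<in>{1..n} - {i, j}. x k) = (\<Sum>k\<in>{1..n} - {i, j}. y k)"
    using assms(5) by (intro sum.cong) auto
  moreover have "(\<Sum>k\<in>{i, j}. x k) = (\<Sum>k\<in>{i, j}. y k)"
    using assms(3,4) by (cases "i = j") auto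
  ultimately show ?case
    unfolding avg_def split[of x] split[of y] by simp
qed

lemma welfare_upper_avg:
  assumes "finite Y"
  shows "welfare Y upper_avg"
proof
  obtain e where e: "e > 0" "\<And>a b. a \<in> Y \<Longrightarrow> b \<in> Y \<Longrightarrow> a < b \<Longrightarrow> a + e \<le> b"
    using finite_set_gap[OF assms] by metis
  define B where "B = Max (abs ` Y)"
  have B: "\<bar>a\<bar> \<le> B" if "a \<in> Y" for a
    using assms that by (simp add: B_def)
  have seqsD: "x i \<in> Y" if "x \<in> seqs Y" "i \<ge> 1" for x i
    using that by (auto simp: seqs_def)
  have less: "upper_avg y < upper_avg x"
    if "x \<in> seqs Y" "y \<in> seqs Y" "\<forall>n\<in>{1..}. y n \<le> x n"
      \<comment> \<open>The minimal gap \<open>e\<close> of \<open>Y\<close> turns each strict gain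
        into a gain of at least \<open>e\<close>, which \<open>avg_gap\<close> converts into
        \<open>e / 2\<close> for the averages.\<close>
      "has_density S 1" "\<forall>i\<in>S. y i < x i" for x y S
    using that e B seqsD
    by (intro upper_avg_less[of x B y "e / 2"] avg_gap[of S]) auto
  show "density_one_pareto (seqs Y) (represented_order (seqs Y) upper_avg)"
    unfolding density_one_pareto_def
  proof (intro ballI impI, elim conjE exE)
    fix x y S
    assume xy: "x \<in> seqs Y" "y \<in> seqs Y" "\<forall>n\<in>{1..}. y n \<le> x n"
      and S: "has_density S 1" "\<forall>i\<in>S. y i < x i"
    show "strictly_preferred (represented_order (seqs Y) upper_avg) x y"
      using less[OF xy S] xy(1,2) by (simp add: strictly_preferred_def represented_order_def)
  qed
  show "anonymity (seqs Y) (represented_order (seqs Y) upper_avg)"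
    unfolding anonymity_def
  proof (intro ballI impI, elim bexE conjE)
    fix x y :: "nat \<Rightarrow> real" and i j :: nat
    assume xy: "x \<in> seqs Y" "y \<in> seqs Y"
      and ij: "i \<in> {1..}" "j \<in> {1..}" "y j = x i" "x j = y i" "\<forall>k\<in>{1..} - {i, j}. y k = x k"
    have "upper_avg x = upper_avg y"
      by (rule upper_avg_cong, rule avg_swap[of i j]) (use ij in auto)
    with xy show "indifferent (represented_order (seqs Y) upper_avg) x y"
      by (simp add: indifferent_def represented_order_def)
  qed
qed

theorem theorem1:
  fixes Y :: "real set"
  assumes "Y \<noteq> {}"
  shows "(\<exists>W :: (nat \<Rightarrow> real) \<Rightarrow> real.
            density_one_pareto (seqs Y) (represented_order (seqs Y) W) \<and>
            anonymity (seqs Y) (represented_order (seqs Y) W))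
         \<longleftrightarrow> finite Y"
proof (intro iffI)
  assume "finite Y"
  then have "welfare Y upper_avg" by (rule welfare_upper_avg)
  then show "\<exists>W. density_one_pareto (seqs Y) (represented_order (seqs Y) W) \<and>
      anonymity (seqs Y) (represented_order (seqs Y) W)"
    by (intro exI[of _ upper_avg] conjI welfare.dop welfare.anon)
next
  assume "\<exists>W. density_one_pareto (seqs Y) (represented_order (seqs Y) W) \<and>
      anonymity (seqs Y) (represented_order (seqs Y) W)"
  then obtain W where "density_one_pareto (seqs Y) (represented_order (seqs Y) W)"
    "anonymity (seqs Y) (represented_order (seqs Y) W)"
    by (elim exE conjE)
  then have "welfare Y W" by (rule welfare.intro)
  then show "finite Y" by (rule welfare.finite_Y)
qed

end
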